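(* Let $\Omega$ be a set, let $\mathcal{C}$ be a collection of subsets of $\Omega$, and let $\mathcal{F}=\sigma(\mathcal{C})$. Suppose that for every $A\in\mathcal{C}$ one has $A^{c}=\Omega\setminus A\in\kappa(\mathcal{C})$. Then for every $\omega\in\Omega$, $$A_{\mathcal{F}}(\omega)=A_{\mathcal{C}}(\omega).$$
   Context: For a collection $\mathcal{C}$ of subsets of $\Omega$: $\sigma(\mathcal{C})$ is the smallest $\sigma$-algebra on $\Omega$ containing $\mathcal{C}$. A collection of subsets of $\Omega$ is called a $\kappa$ class if it is closed under countable intersection and countable union; $\kappa(\mathcal{C})$ is the smallest $\kappa$ class containing $\mathcal{C}$. For $\omega\in\Omega$, $\mathcal{C}_{\omega}=\{B\in\mathcal{C}: \omega\in B\}$ and $A_{\mathcal{C}}(\omega)=\bigcap_{B\in\mathcal{C}_{\omega}}B$, with the convention $A_{\mathcal{C}}(\omega)=\emptyset$ if $\mathcal{C}_\omega$ is empty. The atom of the $\sigma$-algebra $\mathcal{F}$ containing $\omega$ is $A_{\mathcal{F}}(\omega)=\bigcap_{B\in\mathcal{F},\,\omega\in B}B$.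
   Formalization: The collection C is assumed nonempty (for C empty and Ω nonempty the claim fails: the atom of σ(C) is Ω but A_C(ω)=∅ by convention), and κ classes are closed under unions and intersections of nonempty countable families. *)

theory Defs
  imports "HOL-Analysis.Sigma_Algebra"
begin

text \<open>
  The families are required to be nonempty: an intersection or union of countably many sets
  \<open>A\<^sub>1, A\<^sub>2, \<dots>\<close> has at least one member.  In particular a \<open>\<kappa>\<close> class on \<open>\<Omega>\<close> need not
  contain \<open>{}\<close> or \<open>\<Omega>\<close>.
\<close>

definition kappa_class :: "'a set \<Rightarrow> 'a set set \<Rightarrow> bool" where
  "kappa_class \<Omega> K \<longleftrightarrow> K \<subseteq> Pow \<Omega> \<and>
     (\<forall>D. D \<subseteq> K \<longrightarrow> countable D \<longrightarrow> D \<noteq> {} \<longrightarrow> \<Inter>D \<in> K \<and> \<Union>D \<in> K)"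

definition kappa :: "'a set \<Rightarrow> 'a set set \<Rightarrow> 'a set set" where
  "kappa \<Omega> C = \<Inter>{K. kappa_class \<Omega> K \<and> C \<subseteq> K}"

definition members_at :: "'a set set \<Rightarrow> 'a \<Rightarrow> 'a set set" where
  "members_at C \<omega> = {B \<in> C. \<omega> \<in> B}"

text \<open>The case distinction is needed because \<open>\<Inter>{} = UNIV\<close> in HOL.\<close>

definition atom_at :: "'a set set \<Rightarrow> 'a \<Rightarrow> 'a set" where
  "atom_at C \<omega> = (if members_at C \<omega> = {} then {} else \<Inter>(members_at C \<omega>))"

text \<open>For \<open>C \<subseteq> Pow \<Omega>\<close>, the family intersected in \<open>kappa\<close> contains \<open>Pow \<Omega>\<close>, so \<open>kappa \<Omega> C\<close> is
  indeed the smallest \<open>\<kappa>\<close> class containing \<open>C\<close>.\<close>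

lemma kappa_class_Pow: "kappa_class \<Omega> (Pow \<Omega>)"
  unfolding kappa_class_def by blast

lemma kappa_class_kappa:
  assumes "C \<subseteq> Pow \<Omega>"
  shows "kappa_class \<Omega> (kappa \<Omega> C)"
proof -
  have "kappa \<Omega> C \<subseteq> Pow \<Omega>"
    using kappa_class_Pow assms unfolding kappa_def by blast
  moreover have "\<Inter>D \<in> kappa \<Omega> C \<and> \<Union>D \<in> kappa \<Omega> C"
    if D: "D \<subseteq> kappa \<Omega> C" "countable D" "D \<noteq> {}" for D
  proof -
    have "\<Inter>D \<in> K \<and> \<Union>D \<in> K" if "kappa_class \<Omega> K" "C \<subseteq> K" for K
    proof -
      have "D \<subseteq> K" using D(1) that unfolding kappa_def by blast
      then show ?thesis using that(1) D(2,3) unfolding kappa_class_def by blast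
    qed
    then show ?thesis unfolding kappa_def by blast
  qed
  ultimately show ?thesis unfolding kappa_class_def by blast
qed

lemma subset_kappa: "C \<subseteq> kappa \<Omega> C"
  unfolding kappa_def by blast

lemma kappa_least: "kappa_class \<Omega> K \<Longrightarrow> C \<subseteq> K \<Longrightarrow> kappa \<Omega> C \<subseteq> K"
  unfolding kappa_def by blast

end

theory Submission imports Defs begin

text \<open>
  Fix \<open>\<omega> \<in> \<Omega>\<close> and let \<open>A\<close> be the intersection of the members of \<open>C\<close> containing \<open>\<omega>\<close>.  The sets
  that contain \<open>A\<close> as soon as they contain \<open>\<omega>\<close> form a \<open>\<kappa>\<close> class, so every member of \<open>\<kappa>(C)\<close>
  has this property (\<open>atom_at_subset_of_kappa\<close>).  Applied to the complements of the members
  of \<open>C\<close>, it shows that each member of \<open>C\<close> either contains \<open>\<omega>\<close> and all of \<open>A\<close>, or neither \<open>\<omega>\<close>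
  nor any point of \<open>A\<close>.  This dichotomy is stable under complements and countable unions, hence
  holds for every member of \<open>\<sigma>(C)\<close> (\<open>sigma_sets_dichotomy\<close>).  So \<open>A\<close> is contained in the atom
  of \<open>\<sigma>(C)\<close> at \<open>\<omega>\<close>; the other inclusion holds because \<open>C \<subseteq> \<sigma>(C)\<close>.
\<close>

text \<open>
  The first conclusion says that some member of \<open>C\<close> contains \<open>\<omega>\<close>, so that \<open>atom_at C \<omega>\<close> is a
  genuine intersection and not the conventional value \<open>{}\<close>.
\<close>

lemma atom_at_subset_of_kappa:
  assumes "C \<subseteq> Pow \<Omega>" and "B \<in> kappa \<Omega> C" and "\<omega> \<in> B"
  shows "members_at C \<omega> \<noteq> {}" and "atom_at C \<omega> \<subseteq> B"
proof -
  define K where "K = {B \<in> Pow \<Omega>. \<omega> \<in> B \<longrightarrow> members_at C \<omega> \<noteq> {} \<and> atom_at C \<omega> \<subseteq> B}"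
  have K_I: "E \<in> K" if "E \<subseteq> \<Omega>" "\<omega> \<in> E \<Longrightarrow> members_at C \<omega> \<noteq> {} \<and> atom_at C \<omega> \<subseteq> E" for E
    using that unfolding K_def by simp
  have K_Pow: "E \<subseteq> \<Omega>" if "E \<in> K" for E
    using that unfolding K_def by simp
  have K_D: "members_at C \<omega> \<noteq> {} \<and> atom_at C \<omega> \<subseteq> E" if "E \<in> K" "\<omega> \<in> E" for E
    using that unfolding K_def by simp
  have "\<Inter>D \<in> K" if D: "D \<subseteq> K" "D \<noteq> {}" for D
  proof (rule K_I)
    obtain E where E: "E \<in> D" "E \<in> K"
      using D by blast
    show "\<Inter>D \<subseteq> \<Omega>"
      using E K_Pow[of E] by blast
    assume \<omega>: "\<omega> \<in> \<Inter>D"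
    then have "members_at C \<omega> \<noteq> {}"
      using E K_D[of E] by blast
    moreover have "atom_at C \<omega> \<subseteq> \<Inter>D"
    proof (rule Inter_greatest)
      fix E' assume "E' \<in> D"
      then show "atom_at C \<omega> \<subseteq> E'" using D(1) \<omega> K_D[of E'] by blast
    qed
    ultimately show "members_at C \<omega> \<noteq> {} \<and> atom_at C \<omega> \<subseteq> \<Inter>D" ..
  qed
  moreover have "\<Union>D \<in> K" if D: "D \<subseteq> K" for D
  proof (rule K_I)
    show "\<Union>D \<subseteq> \<Omega>"
      using D K_Pow by (meson Sup_least subsetD)
    assume "\<omega> \<in> \<Union>D"
    then obtain E where E: "E \<in> D" "\<omega> \<in> E" by (rule UnionE)
    then have "members_at C \<omega> \<noteq> {} \<and> atom_at C \<omega> \<subseteq> E"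
      using D by (intro K_D) auto
    then show "members_at C \<omega> \<noteq> {} \<and> atom_at C \<omega> \<subseteq> \<Union>D"
      using E(1) by (meson Union_upper order_trans)
  qed
  moreover have "K \<subseteq> Pow \<Omega>"
    unfolding K_def by blast
  ultimately have "kappa_class \<Omega> K"
    unfolding kappa_class_def by simp
  moreover have "C \<subseteq> K"
    using assms(1) unfolding K_def atom_at_def members_at_def by auto
  ultimately have "B \<in> K"
    using kappa_least assms(2) by blast
  then show "members_at C \<omega> \<noteq> {}" and "atom_at C \<omega> \<subseteq> B"
    using assms(3) unfolding K_def by auto
qed

lemma sigma_sets_dichotomy:
  assumes "B \<in> sigma_sets \<Omega> C"
    and "A \<subseteq> \<Omega>"
    and "\<omega> \<in> \<Omega>"
    and "\<And>B. B \<in> C \<Longrightarrow> if \<omega> \<in> B then A \<subseteq> B else A \<inter> B = {}"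
  shows "if \<omega> \<in> B then A \<subseteq> B else A \<inter> B = {}"
  using assms(1)
proof induction
  case (Basic B)
  then show ?case by (rule assms(4))
next
  case Empty
  then show ?case by simp
next
  case (Compl B)
  then show ?case using assms(2,3) by (cases "\<omega> \<in> B") auto
next
  case (Union B)
  show ?case
  proof (cases "\<omega> \<in> \<Union>(range B)")
    case True
    then obtain i where "\<omega> \<in> B i" by blast
    then have "A \<subseteq> B i" using Union.IH[of i] by simp
    then show ?thesis using True by auto
  next
    case False
    then have "A \<inter> B i = {}" for i using Union.IH[of i] by simp
    then show ?thesis using False by auto
  qed
qed

theorem theorem3p1:
  fixes \<Omega> :: "'a set" and C F :: "'a set set"
  assumes "C \<subseteq> Pow \<Omega>"
    and "C \<noteq> {}"
    and "F = sigma_sets \<Omega> C"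
    and "\<And>A. A \<in> C \<Longrightarrow> \<Omega> - A \<in> kappa \<Omega> C"
  shows "\<forall>\<omega>\<in>\<Omega>. atom_at F \<omega> = atom_at C \<omega>"
proof
  fix \<omega> assume \<omega>: "\<omega> \<in> \<Omega>"
  obtain A where A: "A \<in> C"
    using assms(2) by blast
  \<comment> \<open>\<open>\<omega>\<close> lies in \<open>A\<close> or in its complement, and both belong to \<open>\<kappa>(C)\<close>.\<close>
  have nonempty: "members_at C \<omega> \<noteq> {}"
  proof (cases "\<omega> \<in> A")
    case True
    then show ?thesis using A unfolding members_at_def by blast
  next
    case False
    then show ?thesis
      using atom_at_subset_of_kappa(1)[OF assms(1) assms(4)[OF A]] \<omega> by blast
  qed
  then have atom: "atom_at C \<omega> = \<Inter>(members_at C \<omega>)"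
    unfolding atom_at_def by simp
  have atom_subset: "atom_at C \<omega> \<subseteq> \<Omega>"
    using nonempty assms(1) unfolding atom members_at_def by blast
  have dichotomy: "if \<omega> \<in> B then atom_at C \<omega> \<subseteq> B else atom_at C \<omega> \<inter> B = {}" if B: "B \<in> C" for B
  proof (cases "\<omega> \<in> B")
    case True
    then show ?thesis using B unfolding atom members_at_def by auto
  next
    case False
    then show ?thesis
      using atom_at_subset_of_kappa(2)[OF assms(1) assms(4)[OF B]] \<omega> by auto
  qed
  have subset: "members_at C \<omega> \<subseteq> members_at F \<omega>"
    unfolding members_at_def assms(3) by auto
  then have atom_F: "atom_at F \<omega> = \<Inter>(members_at F \<omega>)"
    using nonempty unfolding atom_at_def by auto
  show "atom_at F \<omega> = atom_at C \<omega>"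
  proof
    show "atom_at F \<omega> \<subseteq> atom_at C \<omega>"
      unfolding atom_F atom using subset by blast
    have "atom_at C \<omega> \<subseteq> B" if "B \<in> F" "\<omega> \<in> B" for B
      using sigma_sets_dichotomy[OF _ atom_subset \<omega> dichotomy, of B] that assms(3) by simp
    then show "atom_at C \<omega> \<subseteq> atom_at F \<omega>"
      unfolding atom_F members_at_def by blast
  qed
qed

end
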